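(* For every integer $k\ge 3$, $$\beta(k)\le \frac{1}{k^k}.$$ Moreover, equality is attained only by the following weight functions: if $n$ is a positive integer and $w:E(K_n)\to\mathbb{R}$ is a weight function with $\beta(w,C_k)=\frac{1}{k^k}$, then there is a cycle $C$ of length $k$ in $K_n$ such that $w(e)=\frac1k$ for every $e\in E(C)$ and $w(e)=0$ for every $e\in E(K_n)\setminus E(C)$.
   Context: For a positive integer $n$, $K_n$ is the complete graph on $n$ vertices. A weight function on $K_n$ is a function $w:E(K_n)\to\mathbb{R}$ with $w(e)\ge 0$ for all $e\in E(K_n)$ and $\sum_{e\in E(K_n)}w(e)=1$. For a subgraph $H'$ of $K_n$ put $p_w(H')=\prod_{e\in E(H')}w(e)$. For an integer $k\ge 3$, let $\beta(w,C_k)=\sum_{C'} p_w(C')$, where the sum is over all subgraphs $C'$ of $K_n$ isomorphic to the cycle $C_k$ of length $k$. Finally, $\beta(k)=\sup_w\beta(w,C_k)$, where the supremum is over all positive integers $n$ and all weight functions $w$ on $K_n$. *)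

theory Defs
  imports "HOL-Analysis.Analysis"
begin

text \<open>A simple graph is a pair (vertex set, edge set), where edges are two-element sets of vertices.\<close>

type_synonym 'a ugraph = "'a set \<times> 'a set set"

abbreviation verts :: "'a ugraph \<Rightarrow> 'a set" where "verts G \<equiv> fst G"
abbreviation edges :: "'a ugraph \<Rightarrow> 'a set set" where "edges G \<equiv> snd G"

definition simple_graph :: "'a ugraph \<Rightarrow> bool" where
  "simple_graph G \<longleftrightarrow> (\<forall>e\<in>edges G. e \<subseteq> verts G \<and> card e = 2)"

definition subgraph :: "'a ugraph \<Rightarrow> 'a ugraph \<Rightarrow> bool" where
  "subgraph H G \<longleftrightarrow> simple_graph H \<and> verts H \<subseteq> verts G \<and> edges H \<subseteq> edges G"

definition isomorphic :: "'a ugraph \<Rightarrow> 'b ugraph \<Rightarrow> bool" where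
  "isomorphic G H \<longleftrightarrow>
     (\<exists>f. bij_betw f (verts G) (verts H) \<and>
       (\<forall>u\<in>verts G. \<forall>v\<in>verts G. {u, v} \<in> edges G \<longleftrightarrow> {f u, f v} \<in> edges H))"

definition complete_graph :: "nat \<Rightarrow> nat ugraph" where
  "complete_graph n = ({..<n}, {e. e \<subseteq> {..<n} \<and> card e = 2})"

text \<open>For \<open>k < 3\<close> this is not a cycle (\<open>k = 1\<close> would give a loop); it is only used for \<open>k \<ge> 3\<close>.\<close>

definition cycle_graph :: "nat \<Rightarrow> nat ugraph" where
  "cycle_graph k = ({..<k}, {{i, Suc i mod k} | i. i < k})"

text \<open>A weight function is a total function on sets of vertices; only its values on
  the edges of the complete graph are ever used.\<close>

definition weight_function :: "nat \<Rightarrow> (nat set \<Rightarrow> real) \<Rightarrow> bool" where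
  "weight_function n w \<longleftrightarrow>
     (\<forall>e\<in>edges (complete_graph n). 0 \<le> w e) \<and> (\<Sum>e\<in>edges (complete_graph n). w e) = 1"

definition subgraph_weight :: "(nat set \<Rightarrow> real) \<Rightarrow> nat ugraph \<Rightarrow> real" where
  "subgraph_weight w H = (\<Prod>e\<in>edges H. w e)"

definition cycles_in :: "nat \<Rightarrow> nat \<Rightarrow> nat ugraph set" where
  "cycles_in n k = {C. subgraph C (complete_graph n) \<and> isomorphic C (cycle_graph k)}"

definition beta_weight :: "nat \<Rightarrow> (nat set \<Rightarrow> real) \<Rightarrow> nat \<Rightarrow> real" where
  "beta_weight n w k = (\<Sum>C\<in>cycles_in n k. subgraph_weight w C)"

definition beta_values :: "nat \<Rightarrow> real set" where
  "beta_values k = {beta_weight n w k | n w. n > 0 \<and> weight_function n w}"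

definition beta :: "nat \<Rightarrow> real" where
  "beta k = Sup (beta_values k)"

text \<open>The supremum of an empty or unbounded set of reals is unspecified, and a sum over
  an infinite set is 0. The facts below show that neither occurs here.\<close>

lemma finite_edges_complete_graph: "finite (edges (complete_graph n))"
  by (rule finite_subset[of _ "Pow {..<n}"]) (auto simp: complete_graph_def)

lemma finite_cycles_in: "finite (cycles_in n k)"
  by (rule finite_subset[of _ "Pow {..<n} \<times> Pow (edges (complete_graph n))"])
     (auto simp: cycles_in_def subgraph_def finite_edges_complete_graph,
      auto simp: complete_graph_def)

lemma beta_values_nonempty: "beta_values k \<noteq> {}"
proof -
  have "edges (complete_graph 2) = {{0, 1}}"
  proof -
    have "{..<2::nat} = {0, 1}" by auto
    then show ?thesis
      by (auto simp: complete_graph_def card_2_iff doubleton_eq_iff)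
  qed
  then have "weight_function 2 (\<lambda>_. 1)"
    by (simp add: weight_function_def)
  then show ?thesis
    unfolding beta_values_def by (auto intro!: exI[of _ "2::nat"])
qed

lemma verts_cycles_in:
  assumes "k \<ge> 3" and "C \<in> cycles_in n k"
  shows "verts C = \<Union> (edges C)"
proof
  show "\<Union> (edges C) \<subseteq> verts C"
    using assms by (auto simp: cycles_in_def subgraph_def simple_graph_def)
next
  obtain f where f: "bij_betw f (verts C) {..<k}"
    and fe: "\<And>u v. u \<in> verts C \<Longrightarrow> v \<in> verts C \<Longrightarrow>
      {u, v} \<in> edges C \<longleftrightarrow> {f u, f v} \<in> edges (cycle_graph k)"
    using assms by (auto simp: cycles_in_def isomorphic_def cycle_graph_def)
  show "verts C \<subseteq> \<Union> (edges C)"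
  proof
    fix u assume u: "u \<in> verts C"
    have fu: "f u < k" using f u by (auto simp: bij_betw_def)
    have "Suc (f u) mod k \<in> {..<k}" using assms(1) by auto
    then obtain v where v: "v \<in> verts C" "f v = Suc (f u) mod k"
      using f by (metis bij_betw_imp_surj_on imageE)
    have "{f u, f v} \<in> edges (cycle_graph k)"
      using fu v(2) by (auto simp: cycle_graph_def)
    then have "{u, v} \<in> edges C" using fe u v(1) by blast
    then show "u \<in> \<Union> (edges C)" by blast
  qed
qed

lemma beta_weight_le_exp:
  assumes k: "k \<ge> 3" and w: "weight_function n w"
  shows "beta_weight n w k \<le> exp 1"
proof -
  let ?E = "edges (complete_graph n)"
  have nonneg: "\<And>e. e \<in> ?E \<Longrightarrow> 0 \<le> w e" and sum1: "(\<Sum>e\<in>?E. w e) = 1"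
    using w by (auto simp: weight_function_def)
  have inj: "inj_on snd (cycles_in n k)"
    by (rule inj_onI) (metis verts_cycles_in[OF k] prod.collapse)
  have sub: "edges ` cycles_in n k \<subseteq> Pow ?E"
    by (auto simp: cycles_in_def subgraph_def)
  have "beta_weight n w k = (\<Sum>S\<in>edges ` cycles_in n k. \<Prod>e\<in>S. w e)"
    unfolding beta_weight_def subgraph_weight_def by (simp add: sum.reindex[OF inj])
  also have "\<dots> \<le> (\<Sum>S\<in>Pow ?E. \<Prod>e\<in>S. w e)"
    using sub by (intro sum_mono2) (auto simp: finite_edges_complete_graph intro!: prod_nonneg nonneg)
  also have "\<dots> = (\<Prod>e\<in>?E. w e + 1)"
    using prod_add[OF finite_edges_complete_graph, of w "\<lambda>_. 1" n] by simp
  also have "\<dots> \<le> (\<Prod>e\<in>?E. exp (w e))"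
    by (rule prod_mono) (auto simp: nonneg exp_ge_add_one_self add.commute)
  also have "\<dots> = exp 1"
    by (simp add: exp_sum[OF finite_edges_complete_graph, symmetric] sum1)
  finally show ?thesis .
qed

lemma bdd_above_beta_values: "k \<ge> 3 \<Longrightarrow> bdd_above (beta_values k)"
  by (rule bdd_aboveI[of _ "exp 1"]) (auto simp: beta_values_def intro: beta_weight_le_exp)

end

theory Submission
  imports Defs
begin

text \<open>Explore the weighted complete graph by a random self-avoiding walk. Its first edge is drawn with
probability equal to its weight and is given a uniformly random orientation; afterwards the walk
moves from its last vertex to a new vertex, with probability proportional to the weight of the
connecting edge. The events that the first \<open>k\<close> vertices, read cyclically, run
through a given cycle are disjoint for distinct cycles. So the bound \<open>1 / k ^ k\<close>
follows once each cycle \<open>C\<close> is seen to be traced with probability at least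
\<open>k ^ k\<close> times the product of its weights (\<open>tracing_prob_ge\<close>).

Let \<open>x\<^sub>0, \<dots>, x\<^sub>m\<close> with \<open>m = k - 1\<close> be a traversal of
\<open>C\<close>, let \<open>c\<close> be the weight of the closing edge
\<open>x\<^sub>m x\<^sub>0\<close>, and let \<open>a\<^sub>i\<close> be the total weight of the
edges from \<open>x\<^sub>i\<close> to vertices outside
\<open>{x\<^sub>0, \<dots>, x\<^sub>i}\<close>. The walk follows this traversal with probability
\<open>p / (2 c a\<^sub>1 \<dots> a\<^bsub>m-1\<^esub>)\<close>, where \<open>p\<close> is the product
of the weights on \<open>C\<close>, provided that \<open>p\<close> is positive. Besides
\<open>2\<close>, the denominator contains \<open>m\<close> factors, and their sum, averaged over the \<open>k\<close> rotations of the traversal, is at most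
\<open>m / k\<close>. Indeed, the closing edges contribute at most \<open>1\<close> to the sum over
all rotations. All the numbers \<open>a\<^sub>0, \<dots>, a\<^sub>m\<close> of one rotation add up
to the weight \<open>I \<le> 1\<close> of the edges that meet \<open>C\<close>, because
\<open>a\<^sub>i\<close> collects the edges whose first endpoint on the traversal is
\<open>x\<^sub>i\<close>; and the omitted terms \<open>a\<^sub>0\<close> and
\<open>a\<^sub>m\<close> add up to \<open>2 I\<close> over all rotations, which is seen by comparing
the traversal with its reversal. So the \<open>a\<^sub>i\<close> contribute at most
\<open>k - 2\<close> in total (\<open>sum_forward_weight_rotations\<close>).

By convexity the probabilities of the \<open>k\<close> rotations add up to at least
\<open>k ^ k * p / 2\<close>, and the reversed traversal supplies the other half. Convexity enters
through a tangent line bound for the product of reciprocals, which is strict as soon as one factor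
differs from \<open>1 / k\<close>. Every edge of \<open>C\<close> is the closing edge of some rotation.
Hence equality in the theorem forces weight \<open>1 / k\<close> on every edge of each cycle of
positive weight; as these \<open>k\<close> edges already have total weight \<open>1\<close>, nothing
is left for the other edges.\<close>

section \<open>Vertex lists as closed traversals and as walks\<close>

definition closed_edge :: "nat list \<Rightarrow> nat \<Rightarrow> nat set" where
  "closed_edge xs i = {xs ! i, xs ! (Suc i mod length xs)}"

definition closed_edges :: "nat list \<Rightarrow> nat set set" where
  "closed_edges xs = closed_edge xs ` {..<length xs}"

definition distinct_lists :: "nat \<Rightarrow> nat \<Rightarrow> nat list set" where
  "distinct_lists n m = {xs. length xs = m \<and> distinct xs \<and> set xs \<subseteq> {..<n}}"

text \<open>The weight from the \<open>i\<close>-th vertex to the vertices that a walk along \<open>xs\<close> has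
not visited when it stands there.\<close>

definition forward_weight :: "nat \<Rightarrow> (nat set \<Rightarrow> real) \<Rightarrow> nat list \<Rightarrow> nat \<Rightarrow> real" where
  "forward_weight n w xs i = (\<Sum>y\<in>{..<n} - set (take (Suc i) xs). w {xs ! i, y})"

text \<open>The probability that the random self-avoiding walk begins with \<open>xs\<close>. If the forward
weight vanishes, the walk is stuck; the quotient is then zero by the convention for division.\<close>

definition walk_prob :: "nat \<Rightarrow> (nat set \<Rightarrow> real) \<Rightarrow> nat list \<Rightarrow> real" where
  "walk_prob n w xs = w {xs ! 0, xs ! 1} / 2 *
     (\<Prod>i\<in>{1..<length xs - 1}. w {xs ! i, xs ! Suc i} / forward_weight n w xs i)"

lemma doubleton_in_complete_graph:
  "{a, b} \<in> edges (complete_graph n) \<longleftrightarrow> a < n \<and> b < n \<and> a \<noteq> b"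
  by (auto simp: complete_graph_def card_2_iff doubleton_eq_iff)

lemma edge_of_complete_graphE:
  assumes "e \<in> edges (complete_graph n)"
  obtains a b where "e = {a, b}" "a < n" "b < n" "a \<noteq> b"
  using assms by (auto simp: complete_graph_def card_2_iff)

lemma nth_lt_if_set_subset: "set xs \<subseteq> {..<n} \<Longrightarrow> i < length xs \<Longrightarrow> xs ! i < (n::nat)"
  using nth_mem by blast

lemma finite_distinct_lists: "finite (distinct_lists n m)"
  by (rule finite_subset[OF _ finite_lists_length_eq[of "{..<n}" m]]) (auto simp: distinct_lists_def)

lemma distinct_lists_Suc:
  "bij_betw (\<lambda>(xs, y). xs @ [y]) (SIGMA xs:distinct_lists n m. {..<n} - set xs) (distinct_lists n (Suc m))"
proof (rule bij_betw_imageI)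
  show "inj_on (\<lambda>(xs, y). xs @ [y]) (SIGMA xs:distinct_lists n m. {..<n} - set xs)"
    by (auto simp: inj_on_def)
  have "\<exists>xs y. zs = xs @ [y] \<and> xs \<in> distinct_lists n m \<and> y \<in> {..<n} - set xs"
    if "zs \<in> distinct_lists n (Suc m)" for zs
    using that by (cases zs rule: rev_cases) (auto simp: distinct_lists_def)
  then show "(\<lambda>(xs, y). xs @ [y]) ` (SIGMA xs:distinct_lists n m. {..<n} - set xs) = distinct_lists n (Suc m)"
    by (force simp: distinct_lists_def image_iff)
qed

lemma sum_distinct_lists_Suc:
  "(\<Sum>zs\<in>distinct_lists n (Suc m). g zs) =
   (\<Sum>xs\<in>distinct_lists n m. \<Sum>y\<in>{..<n} - set xs. g (xs @ [y]))"
proof -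
  have "(\<Sum>zs\<in>distinct_lists n (Suc m). g zs) =
     (\<Sum>p\<in>(SIGMA xs:distinct_lists n m. {..<n} - set xs). g ((\<lambda>(xs, y). xs @ [y]) p))"
    by (rule sum.reindex_bij_betw[OF distinct_lists_Suc, symmetric])
  also have "\<dots> = (\<Sum>xs\<in>distinct_lists n m. \<Sum>y\<in>{..<n} - set xs. g (xs @ [y]))"
    by (subst sum.Sigma) (auto simp: finite_distinct_lists intro!: sum.cong)
  finally show ?thesis .
qed

section \<open>Rotations and reversals of a traversal\<close>

lemma bij_betw_add_mod: "0 < k \<Longrightarrow> bij_betw (\<lambda>r. (r + c) mod k) {..<k} {..<k::nat}"
proof (rule bij_betw_imageI)
  assume "0 < k"
  show inj: "inj_on (\<lambda>r. (r + c) mod k) {..<k}"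
  proof (rule inj_onI)
    fix x y assume xy: "x \<in> {..<k}" "y \<in> {..<k}" "(x + c) mod k = (y + c) mod k"
    have eq: "a = b" if "a \<le> b" "b < k" "(a + c) mod k = (b + c) mod k" for a b
    proof -
      have "k dvd (b + c) - (a + c)"
        using that mod_eq_dvd_iff_nat[of "a + c" "b + c" k] by simp
      then show "a = b" using that(1,2) by (auto dest!: dvd_imp_le)
    qed
    have "x < k" "y < k" using xy by auto
    then show "x = y"
      using eq[of x y, OF _ _ xy(3)] eq[of y x, OF _ _ xy(3)[symmetric]] le_cases[of x y] by metis
  qed
  show "(\<lambda>r. (r + c) mod k) ` {..<k} = {..<k}"
    by (rule card_subset_eq) (use \<open>0 < k\<close> inj in \<open>auto simp: card_image\<close>)
qed

lemma closed_edge_rotate: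
  assumes "i < length xs"
  shows "closed_edge (rotate r xs) i = closed_edge xs ((r + i) mod length xs)"
proof -
  have "Suc i mod length xs < length xs" using assms by (metis gr_implies_not0 mod_less_divisor neq0_conv)
  then show ?thesis
    using assms by (simp add: closed_edge_def nth_rotate mod_simps)
qed

lemma closed_edges_rotate: "closed_edges (rotate r xs) = closed_edges xs"
proof (cases "xs = []")
  case False
  have "closed_edges (rotate r xs) = closed_edge xs ` (\<lambda>i. (i + r) mod length xs) ` {..<length xs}"
    by (auto simp: closed_edges_def closed_edge_rotate image_image add.commute intro!: image_cong)
  also have "(\<lambda>i. (i + r) mod length xs) ` {..<length xs} = {..<length xs}"
    using False by (intro bij_betw_imp_surj_on bij_betw_add_mod) auto
  finally show ?thesis by (simp add: closed_edges_def)
qed simp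

lemma closed_edges_rev: "closed_edges (rev xs) = closed_edges xs"
proof -
  have *: "closed_edges (rev ys) \<subseteq> closed_edges ys" for ys :: "nat list"
  proof
    fix e assume "e \<in> closed_edges (rev ys)"
    then obtain i where i: "i < length ys" "e = closed_edge (rev ys) i"
      by (auto simp: closed_edges_def)
    show "e \<in> closed_edges ys"
    proof (cases "Suc i < length ys")
      case True
      then have "e = closed_edge ys (length ys - Suc (Suc i))"
        using i by (auto simp: closed_edge_def rev_nth Suc_diff_Suc)
      then show ?thesis using True by (auto simp: closed_edges_def)
    next
      case False
      then have "Suc i = length ys" using i by auto
      then have "e = closed_edge ys i"
        using i by (auto simp: closed_edge_def rev_nth simp flip: \<open>Suc i = length ys\<close>)
      then show ?thesis using i by (auto simp: closed_edges_def)
    qed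
  qed
  from *[of xs] *[of "rev xs"] show ?thesis by auto
qed

text \<open>Three vertices are needed: a traversal of two vertices uses its only edge twice.\<close>

lemma inj_on_closed_edge:
  assumes "distinct xs" "3 \<le> length xs"
  shows "inj_on (closed_edge xs) {..<length xs}"
proof (rule inj_onI)
  fix i j assume ij: "i \<in> {..<length xs}" "j \<in> {..<length xs}" and eq: "closed_edge xs i = closed_edge xs j"
  have lt: "Suc l mod length xs < length xs" for l using assms by (intro mod_less_divisor) auto
  from eq have "i = j \<or> (i = Suc j mod length xs \<and> Suc i mod length xs = j)"
    using ij assms lt by (auto simp: closed_edge_def doubleton_eq_iff nth_eq_iff_index_eq)
  then show "i = j"
    using ij assms by (auto simp: mod_Suc split: if_splits)
qed

lemma prod_closed_edges:
  fixes w :: "nat set \<Rightarrow> real"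
  assumes "distinct xs" "length xs = Suc m" "2 \<le> m"
  shows "(\<Prod>e\<in>closed_edges xs. w e) = (\<Prod>i<m. w {xs ! i, xs ! Suc i}) * w {xs ! m, xs ! 0}"
proof -
  have "(\<Prod>e\<in>closed_edges xs. w e) = (\<Prod>i<Suc m. w (closed_edge xs i))"
    unfolding closed_edges_def using inj_on_closed_edge[of xs] assms
    by (simp add: prod.reindex del: prod.lessThan_Suc)
  also have "\<dots> = (\<Prod>i<m. w (closed_edge xs i)) * w (closed_edge xs m)" by simp
  also have "(\<Prod>i<m. w (closed_edge xs i)) = (\<Prod>i<m. w {xs ! i, xs ! Suc i})"
    using assms by (intro prod.cong) (auto simp: closed_edge_def)
  finally show ?thesis using assms by (simp add: closed_edge_def)
qed

lemma closed_edges_subset: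
  assumes "distinct xs" "3 \<le> length xs" "set xs \<subseteq> {..<n}"
  shows "closed_edges xs \<subseteq> edges (complete_graph n)"
proof
  fix e assume "e \<in> closed_edges xs"
  then obtain i where i: "i < length xs" "e = {xs ! i, xs ! (Suc i mod length xs)}"
    by (auto simp: closed_edges_def closed_edge_def)
  have lt: "Suc i mod length xs < length xs" using assms by (intro mod_less_divisor) auto
  have "i \<noteq> Suc i mod length xs" using assms i by (auto simp: mod_Suc)
  then show "e \<in> edges (complete_graph n)"
    using i lt assms by (auto simp: doubleton_in_complete_graph nth_lt_if_set_subset nth_eq_iff_index_eq)
qed

lemma rotate_eq_rotateD:
  assumes "rotate r xs = rotate s ys" "length xs = length ys" "s \<le> length ys"
  shows "ys = rotate (length ys - s + r) xs"
proof -
  have "rotate (length ys - s + r) xs = rotate (length ys - s) (rotate s ys)"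
    unfolding assms(1)[symmetric] rotate_rotate ..
  also have "\<dots> = ys" using assms(3) by (simp add: rotate_rotate)
  finally show ?thesis ..
qed

lemma inj_on_rotate:
  assumes "distinct xs"
  shows "inj_on (\<lambda>r. rotate r xs) {..<length xs}"
proof (rule inj_onI)
  fix r s assume rs: "r \<in> {..<length xs}" "s \<in> {..<length xs}" "rotate r xs = rotate s xs"
  then have "rotate r xs ! 0 = rotate s xs ! 0" "0 < length xs" by auto
  then show "r = s" using rs(1,2) assms by (auto simp: nth_rotate nth_eq_iff_index_eq)
qed

text \<open>A traversal of at least three vertices has an orientation, so a cycle has two classes of traversals
under rotation.\<close>

lemma rev_not_rotate:
  assumes "distinct xs" "3 \<le> length xs"
  shows "rev xs \<noteq> rotate r xs"
proof
  assume eq: "rev xs = rotate r xs"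
  let ?k = "length xs"
  have *: "?k - Suc i = (r + i) mod ?k" if "i < ?k" for i
  proof -
    have "xs ! (?k - Suc i) = xs ! ((r + i) mod ?k)"
      using that eq by (metis nth_rotate rev_nth)
    moreover have "(r + i) mod ?k < ?k" using that by (intro mod_less_divisor) auto
    ultimately show ?thesis using that assms by (simp add: nth_eq_iff_index_eq)
  qed
  have "(r + 1) mod ?k = Suc (r mod ?k) mod ?k" by (simp add: mod_simps)
  also have "r mod ?k = ?k - 1" using *[of 0] assms by (cases xs) auto
  also have "Suc (?k - 1) = ?k" using assms by simp
  finally show False using *[of 1] assms by simp
qed

section \<open>Traversals of a given cycle\<close>

definition tracings :: "nat \<Rightarrow> nat \<Rightarrow> nat set set \<Rightarrow> nat list set" where
  "tracings n k F = {xs\<in>distinct_lists n k. closed_edges xs = F}"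

text \<open>An isomorphism with the standard cycle numbers the vertices of \<open>C\<close> in the order of a
traversal.\<close>

lemma tracing_exists:
  assumes k: "3 \<le> k" and C: "C \<in> cycles_in n k"
  shows "tracings n k (edges C) \<noteq> {}"
proof -
  obtain f where f: "bij_betw f (verts C) {..<k}"
    and fe: "\<And>u v. u \<in> verts C \<Longrightarrow> v \<in> verts C \<Longrightarrow>
      {u, v} \<in> edges C \<longleftrightarrow> {f u, f v} \<in> edges (cycle_graph k)"
    using C by (auto simp: cycles_in_def isomorphic_def cycle_graph_def)
  have sub: "verts C \<subseteq> {..<n}" and edge: "\<And>e. e \<in> edges C \<Longrightarrow> e \<subseteq> verts C \<and> card e = 2"
    using C by (auto simp: cycles_in_def subgraph_def simple_graph_def complete_graph_def)
  define g where "g = inv_into (verts C) f"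
  have g: "bij_betw g {..<k} (verts C)" unfolding g_def by (rule bij_betw_inv_into[OF f])
  have fg: "f (g i) = i" if "i < k" for i
    using that f by (simp add: g_def bij_betw_inv_into_right)
  have gf: "g (f v) = v" if "v \<in> verts C" for v
    using that f by (simp add: g_def bij_betw_inv_into_left)
  have gV: "g i \<in> verts C" if "i < k" for i using g that by (auto simp: bij_betw_def)
  have lt: "Suc i mod k < k" for i using k by simp
  define xs where "xs = map g [0..<k]"
  have ce: "closed_edge xs i = {g i, g (Suc i mod k)}" if "i < k" for i
    using that lt by (simp add: closed_edge_def xs_def)
  have "closed_edges xs = edges C"
  proof (intro equalityI subsetI)
    fix e assume "e \<in> closed_edges xs"
    then obtain i where i: "i < k" "e = {g i, g (Suc i mod k)}"
      using ce by (auto simp: closed_edges_def xs_def)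
    have "{f (g i), f (g (Suc i mod k))} \<in> edges (cycle_graph k)"
      using fg[OF i(1)] fg[OF lt] i(1) by (auto simp: cycle_graph_def)
    then show "e \<in> edges C" using fe[OF gV[OF i(1)] gV[OF lt]] i(2) by simp
  next
    fix e assume e: "e \<in> edges C"
    then obtain u v where uv: "e = {u, v}" "u \<in> verts C" "v \<in> verts C"
      using edge[OF e] by (auto simp: card_2_iff)
    then obtain i where i: "i < k" "{f u, f v} = {i, Suc i mod k}"
      using fe[of u v] e by (auto simp: cycle_graph_def)
    have "e = g ` {f u, f v}" using uv gf by simp
    then have "e = closed_edge xs i" using i ce by simp
    then show "e \<in> closed_edges xs" using i by (auto simp: closed_edges_def xs_def)
  qed
  moreover have "xs \<in> distinct_lists n k"
    using g sub by (auto simp: distinct_lists_def xs_def bij_betw_def distinct_map atLeast0LessThan)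
  ultimately show ?thesis by (auto simp: tracings_def)
qed

section \<open>A tangent bound for products of reciprocals\<close>

text \<open>The tangent plane at \<open>y = 1\<close> lies below the convex function
\<open>\<Prod>j\<in>J. 1 / y j\<close>; both parts come from \<open>ln t \<le> t - 1\<close>, with equality only at
\<open>t = 1\<close>.\<close>

lemma one_plus_sum_le_prod_inverse:
  fixes y :: "'i \<Rightarrow> real"
  assumes "finite J" "\<And>j. j \<in> J \<Longrightarrow> 0 < y j"
  shows "1 + (\<Sum>j\<in>J. 1 - y j) \<le> (\<Prod>j\<in>J. 1 / y j)"
    and "j \<in> J \<Longrightarrow> y j \<noteq> 1 \<Longrightarrow> 1 + (\<Sum>j\<in>J. 1 - y j) < (\<Prod>j\<in>J. 1 / y j)"
proof -
  have pos: "0 < (\<Prod>j\<in>J. 1 / y j)" using assms by (intro prod_pos) auto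
  have ln: "ln (\<Prod>j\<in>J. 1 / y j) = (\<Sum>j\<in>J. - ln (y j))"
  proof -
    have "ln (\<Prod>j\<in>J. 1 / y j) = (\<Sum>j\<in>J. ln (1 / y j))"
    proof (rule ln_prod[OF assms(1)])
      show "1 / y j \<noteq> 0" if "j \<in> J" for j using assms(2)[OF that] by simp
    qed
    also have "\<dots> = (\<Sum>j\<in>J. - ln (y j))"
      using assms(2) by (intro sum.cong) (auto simp: ln_div)
    finally show ?thesis .
  qed
  have le: "ln (\<Prod>j\<in>J. 1 / y j) + 1 \<le> (\<Prod>j\<in>J. 1 / y j)"
    using ln_le_minus_one[OF pos] by simp
  have each: "1 - y j \<le> - ln (y j)" if "j \<in> J" for j
    using ln_le_minus_one[OF assms(2)[OF that]] by simp
  have "(\<Sum>j\<in>J. 1 - y j) \<le> (\<Sum>j\<in>J. - ln (y j))" by (intro sum_mono each)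
  with le ln show "1 + (\<Sum>j\<in>J. 1 - y j) \<le> (\<Prod>j\<in>J. 1 / y j)" by simp
  assume j: "j \<in> J" "y j \<noteq> 1"
  have "1 - y j < - ln (y j)"
    using each[OF j(1)] ln_eq_minus_one[OF assms(2)[OF j(1)]] j(2) by linarith
  then have "(\<Sum>j\<in>J. 1 - y j) < (\<Sum>j\<in>J. - ln (y j))"
    using assms(1) j(1) each by (intro sum_strict_mono_ex1) auto
  with le ln show "1 + (\<Sum>j\<in>J. 1 - y j) < (\<Prod>j\<in>J. 1 / y j)" by simp
qed

section \<open>The random self-avoiding walk\<close>

context
  fixes n :: nat and w :: "nat set \<Rightarrow> real"
  assumes wf: "weight_function n w"
begin

lemma weight_nonneg: "a < n \<Longrightarrow> b < n \<Longrightarrow> a \<noteq> b \<Longrightarrow> 0 \<le> w {a, b}"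
  using wf by (simp add: weight_function_def doubleton_in_complete_graph)

lemma sum_weights_le_one: "A \<subseteq> edges (complete_graph n) \<Longrightarrow> (\<Sum>e\<in>A. w e) \<le> 1"
  using wf sum_mono2[OF finite_edges_complete_graph, of A n w]
  by (auto simp: weight_function_def)

text \<open>Each edge that meets \<open>xs\<close> is counted exactly once, at the earlier of its endpoints on
\<open>xs\<close>.\<close>

lemma sum_forward_weight:
  assumes "distinct xs" "set xs \<subseteq> {..<n}"
  shows "(\<Sum>i<length xs. forward_weight n w xs i) =
    (\<Sum>e\<in>{e\<in>edges (complete_graph n). e \<inter> set xs \<noteq> {}}. w e)"
  using assms
proof (induction xs rule: rev_induct)
  case Nil
  then show ?case by simp
next
  case (snoc x xs)
  let ?E = "edges (complete_graph n)"
  let ?N = "{..<n} - set (xs @ [x])"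
  have inj: "inj_on (\<lambda>y. {x, y}) ?N"
    by (auto simp: inj_on_def doubleton_eq_iff)
  have split: "{e\<in>?E. e \<inter> set (xs @ [x]) \<noteq> {}} =
     {e\<in>?E. e \<inter> set xs \<noteq> {}} \<union> (\<lambda>y. {x, y}) ` ?N"
  proof (intro equalityI subsetI)
    fix e assume e: "e \<in> {e\<in>?E. e \<inter> set (xs @ [x]) \<noteq> {}}"
    then obtain a b where ab: "e = {a, b}" "a < n" "b < n" "a \<noteq> b"
      using edge_of_complete_graphE[of e n] by blast
    show "e \<in> {e\<in>?E. e \<inter> set xs \<noteq> {}} \<union> (\<lambda>y. {x, y}) ` ?N"
    proof (cases "e \<inter> set xs = {}")
      case True
      then have "a = x \<or> b = x" using e ab by auto
      then show ?thesis using True ab by (auto simp: insert_commute)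
    qed (use e in auto)
  next
    fix e assume "e \<in> {e\<in>?E. e \<inter> set xs \<noteq> {}} \<union> (\<lambda>y. {x, y}) ` ?N"
    then show "e \<in> {e\<in>?E. e \<inter> set (xs @ [x]) \<noteq> {}}"
      using snoc.prems by (auto simp: doubleton_in_complete_graph)
  qed
  have "(\<Sum>e\<in>{e\<in>?E. e \<inter> set (xs @ [x]) \<noteq> {}}. w e) =
     (\<Sum>e\<in>{e\<in>?E. e \<inter> set xs \<noteq> {}}. w e) + (\<Sum>e\<in>(\<lambda>y. {x, y}) ` ?N. w e)"
    unfolding split
    using snoc.prems by (intro sum.union_disjoint) (auto simp: finite_edges_complete_graph)
  also have "(\<Sum>e\<in>(\<lambda>y. {x, y}) ` ?N. w e) = forward_weight n w (xs @ [x]) (length xs)"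
    by (simp add: sum.reindex[OF inj] forward_weight_def del: set_append)
  also have "(\<Sum>e\<in>{e\<in>?E. e \<inter> set xs \<noteq> {}}. w e) = (\<Sum>i<length xs. forward_weight n w xs i)"
    using snoc by simp
  also have "\<dots> = (\<Sum>i<length xs. forward_weight n w (xs @ [x]) i)"
    by (rule sum.cong) (auto simp: forward_weight_def nth_append)
  finally show ?case by simp
qed

lemma forward_weight_nonneg:
  assumes "distinct xs" "set xs \<subseteq> {..<n}" "i < length xs"
  shows "0 \<le> forward_weight n w xs i"
  unfolding forward_weight_def
proof (rule sum_nonneg)
  fix y assume y: "y \<in> {..<n} - set (take (Suc i) xs)"
  have "xs ! i \<in> set (take (Suc i) xs)"
    using assms(3) by (simp add: take_Suc_conv_app_nth)
  then show "0 \<le> w {xs ! i, y}"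
    using y assms by (intro weight_nonneg) (auto simp: nth_lt_if_set_subset)
qed

lemma weight_le_forward_weight:
  assumes "distinct xs" "set xs \<subseteq> {..<n}" "Suc i < length xs"
  shows "w {xs ! i, xs ! Suc i} \<le> forward_weight n w xs i"
  unfolding forward_weight_def
proof (rule member_le_sum)
  have "xs ! Suc i \<notin> set (take (Suc i) xs)"
    using assms by (auto simp: in_set_conv_nth nth_eq_iff_index_eq)
  then show "xs ! Suc i \<in> {..<n} - set (take (Suc i) xs)"
    using assms by (auto dest: nth_mem)
  fix y assume y: "y \<in> {..<n} - set (take (Suc i) xs) - {xs ! Suc i}"
  have "xs ! i \<in> set (take (Suc i) xs)"
    using assms(3) by (simp add: take_Suc_conv_app_nth)
  then show "0 \<le> w {xs ! i, y}"
    using y assms by (intro weight_nonneg) (auto simp: nth_lt_if_set_subset)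
qed simp

lemma walk_prob_nonneg:
  assumes "distinct xs" "set xs \<subseteq> {..<n}" "2 \<le> length xs"
  shows "0 \<le> walk_prob n w xs"
proof -
  have nn: "0 \<le> w {xs ! i, xs ! Suc i}" if "Suc i < length xs" for i
    using that assms by (intro weight_nonneg) (auto simp: nth_eq_iff_index_eq nth_lt_if_set_subset)
  then show ?thesis
    unfolding walk_prob_def using nn[of 0] assms
    by (intro mult_nonneg_nonneg prod_nonneg ballI divide_nonneg_nonneg forward_weight_nonneg) auto
qed

lemma walk_prob_snoc:
  assumes "2 \<le> length xs"
  shows "walk_prob n w (xs @ [y]) =
    walk_prob n w xs * (w {last xs, y} / forward_weight n w xs (length xs - 1))"
proof -
  have *: "forward_weight n w (xs @ [y]) i = forward_weight n w xs i" if "i < length xs" for i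
    using that by (simp add: forward_weight_def nth_append)
  obtain m where m: "length xs = Suc (Suc m)"
    using assms by (metis add_2_eq_Suc le_Suc_ex)
  have "{1..<Suc (Suc m)} = insert (Suc m) {1..<Suc m}" by auto
  moreover have "xs \<noteq> []" using m by auto
  ultimately show ?thesis
    using m by (auto simp: walk_prob_def nth_append * last_conv_nth intro!: prod.cong)
qed

text \<open>Extending a walk by all unvisited vertices redistributes its probability, or loses it if the walk is
stuck; hence an inequality.\<close>

lemma sum_walk_prob_le_one: "(\<Sum>xs\<in>distinct_lists n (Suc (Suc m)). walk_prob n w xs) \<le> 1"
proof (induction m)
  case 0
  let ?E = "edges (complete_graph n)"
  let ?P = "SIGMA x:{..<n}. {..<n} - {x}"
  have "(\<Sum>xs\<in>distinct_lists n (Suc (Suc 0)). walk_prob n w xs) =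
      (\<Sum>x<n. \<Sum>y\<in>{..<n} - {x}. w {x, y}) / 2"
  proof -
    have "distinct_lists n 0 = {[]}" by (auto simp: distinct_lists_def)
    then show ?thesis
      by (simp add: sum_distinct_lists_Suc walk_prob_def sum_divide_distrib)
  qed
  also have "(\<Sum>x<n. \<Sum>y\<in>{..<n} - {x}. w {x, y}) = (\<Sum>p\<in>?P. w {fst p, snd p})"
    by (subst sum.Sigma) (auto intro!: sum.cong)
  also have "\<dots> = (\<Sum>e\<in>?E. \<Sum>p\<in>{p\<in>?P. {fst p, snd p} = e}. w {fst p, snd p})"
    by (rule sum.group[symmetric])
       (auto simp: finite_edges_complete_graph doubleton_in_complete_graph)
  \<comment> \<open>Both orientations of an edge start a walk, each with half of the weight of the edge.\<close>
  also have "\<dots> = (\<Sum>e\<in>?E. 2 * w e)"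
  proof (rule sum.cong[OF refl])
    fix e assume "e \<in> ?E"
    then obtain a b where ab: "e = {a, b}" "a < n" "b < n" "a \<noteq> b"
      by (rule edge_of_complete_graphE)
    then have "{p\<in>?P. {fst p, snd p} = e} = {(a, b), (b, a)}"
      by (auto simp: doubleton_eq_iff)
    then show "(\<Sum>p\<in>{p\<in>?P. {fst p, snd p} = e}. w {fst p, snd p}) = 2 * w e"
      using ab by (simp add: insert_commute)
  qed
  also have "\<dots> = 2" using wf by (simp add: weight_function_def flip: sum_distrib_left)
  finally show ?case by simp
next
  case (Suc m)
  have "(\<Sum>xs\<in>distinct_lists n (Suc (Suc (Suc m))). walk_prob n w xs) =
     (\<Sum>xs\<in>distinct_lists n (Suc (Suc m)). \<Sum>y\<in>{..<n} - set xs. walk_prob n w (xs @ [y]))"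
    by (rule sum_distinct_lists_Suc)
  also have "\<dots> \<le> (\<Sum>xs\<in>distinct_lists n (Suc (Suc m)). walk_prob n w xs)"
  proof (rule sum_mono)
    fix xs assume xs: "xs \<in> distinct_lists n (Suc (Suc m))"
    let ?a = "forward_weight n w xs (length xs - 1)"
    have len: "2 \<le> length xs" and ne: "xs \<noteq> []" using xs by (auto simp: distinct_lists_def)
    have a: "(\<Sum>y\<in>{..<n} - set xs. w {last xs, y}) = ?a"
      using ne by (simp add: forward_weight_def last_conv_nth)
    have "(\<Sum>y\<in>{..<n} - set xs. walk_prob n w (xs @ [y])) = walk_prob n w xs * (?a / ?a)"
      unfolding walk_prob_snoc[OF len] sum_distrib_left[symmetric] sum_divide_distrib[symmetric] a
      by (rule refl)
    also have "\<dots> \<le> walk_prob n w xs * 1"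
      using xs len by (intro mult_left_mono walk_prob_nonneg) (auto simp: distinct_lists_def)
    finally show "(\<Sum>y\<in>{..<n} - set xs. walk_prob n w (xs @ [y])) \<le> walk_prob n w xs" by simp
  qed
  also have "\<dots> \<le> 1" by (rule Suc.IH)
  finally show ?case .
qed

section \<open>The probability of tracing a cycle\<close>

text \<open>Leaving out the first and the last vertex of each rotation costs twice the weight \<open>I\<close> of
the edges that meet the cycle: the first vertex has its full weight \<open>d\<close> as forward
weight, the last one only its weight \<open>out\<close> to vertices outside the cycle. Since every
vertex is first once and last once, the claim is that the sums of \<open>d\<close> and
\<open>out\<close> add up to \<open>2 I\<close>. For this, add the forward weights of the traversal
and of its reversal: the vertices other than \<open>x\<close> itself are counted once, those outside
the cycle a second time, while either direction alone gives the sum \<open>I\<close>.\<close>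

lemma sum_forward_weight_rotations:
  assumes "distinct xs" "set xs \<subseteq> {..<n}" "length xs = k" "3 \<le> k"
  shows "(\<Sum>r<k. \<Sum>i\<in>{1..<k - 1}. forward_weight n w (rotate r xs) i) \<le> real k - 2"
proof -
  let ?V = "{..<n}"
  define I where "I = (\<Sum>e\<in>{e\<in>edges (complete_graph n). e \<inter> set xs \<noteq> {}}. w e)"
  define d where "d i = (\<Sum>y\<in>?V - {xs ! i}. w {xs ! i, y})" for i
  define out where "out i = (\<Sum>y\<in>?V - set xs. w {xs ! i, y})" for i
  have I: "(\<Sum>i<k. forward_weight n w ys i) = I"
    if "length ys = k" "distinct ys" "set ys = set xs" for ys
    using sum_forward_weight[of ys] that assms unfolding I_def by simp
  have I1: "I \<le> 1" unfolding I_def by (rule sum_weights_le_one) auto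
  have both: "forward_weight n w xs i + forward_weight n w (rev xs) (k - Suc i) = d i + out i"
    if i: "i < k" for i
  proof -
    have take: "take (Suc (k - Suc i)) (rev xs) = rev (drop i xs)"
      using i assms(3) by (simp add: take_rev Suc_diff_Suc)
    have nth: "rev xs ! (k - Suc i) = xs ! i"
      using i assms(3) by (simp add: rev_nth)
    have hd: "set (take (Suc i) xs) \<inter> set (drop i xs) = {xs ! i}"
    proof -
      have "drop i xs = xs ! i # drop (Suc i) xs" "take (Suc i) xs = take i xs @ [xs ! i]"
        using i assms(3) by (auto simp: Cons_nth_drop_Suc take_Suc_conv_app_nth)
      moreover have "set (take i xs) \<inter> set (drop i xs) = {}"
        "set (take (Suc i) xs) \<inter> set (drop (Suc i) xs) = {}"
        using assms(1) by (auto intro!: set_take_disj_set_drop_if_distinct)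
      ultimately show ?thesis by auto
    qed
    have tl: "set (take (Suc i) xs) \<union> set (drop i xs) = set xs"
    proof -
      have "set (drop i xs) \<union> set (take i xs) = set xs" by (metis append_take_drop_id set_append sup_commute)
      moreover have "set (take i xs) \<subseteq> set (take (Suc i) xs)" by (simp add: set_take_subset_set_take)
      moreover have "set (take (Suc i) xs) \<subseteq> set xs" by (rule set_take_subset)
      ultimately show ?thesis by blast
    qed
    have "forward_weight n w xs i + forward_weight n w (rev xs) (k - Suc i) =
       (\<Sum>y\<in>?V - set (take (Suc i) xs). w {xs ! i, y}) + (\<Sum>y\<in>?V - set (drop i xs). w {xs ! i, y})"
      unfolding forward_weight_def take nth by simp
    also have "\<dots> =
       (\<Sum>y\<in>(?V - set (take (Suc i) xs)) \<union> (?V - set (drop i xs)). w {xs ! i, y}) +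
       (\<Sum>y\<in>(?V - set (take (Suc i) xs)) \<inter> (?V - set (drop i xs)). w {xs ! i, y})"
      by (rule sum.union_inter[symmetric]) auto
    also have "(?V - set (take (Suc i) xs)) \<union> (?V - set (drop i xs)) = ?V - {xs ! i}"
      using hd by blast
    also have "(?V - set (take (Suc i) xs)) \<inter> (?V - set (drop i xs)) = ?V - set xs"
      using tl by blast
    finally show ?thesis by (simp add: d_def out_def)
  qed
  have "(\<Sum>i<k. d i) + (\<Sum>i<k. out i) =
      (\<Sum>i<k. forward_weight n w xs i) + (\<Sum>i<k. forward_weight n w (rev xs) (k - Suc i))"
    by (simp add: both flip: sum.distrib)
  also have "(\<Sum>i<k. forward_weight n w (rev xs) (k - Suc i)) = (\<Sum>i<k. forward_weight n w (rev xs) i)"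
    by (rule sum.nat_diff_reindex)
  finally have twice: "(\<Sum>i<k. d i) + (\<Sum>i<k. out i) = 2 * I"
    using I[of xs] I[of "rev xs"] assms by simp
  have first: "(\<Sum>r<k. forward_weight n w (rotate r xs) 0) = (\<Sum>i<k. d i)"
  proof (rule sum.cong[OF refl])
    fix r assume "r \<in> {..<k}"
    then have "rotate r xs ! 0 = xs ! r" "rotate r xs \<noteq> []"
      using assms by (auto simp: nth_rotate)
    then show "forward_weight n w (rotate r xs) 0 = d r"
      using take_Suc_conv_app_nth[of 0 "rotate r xs"] by (simp add: forward_weight_def d_def)
  qed
  have "(\<Sum>r<k. forward_weight n w (rotate r xs) (k - 1)) = (\<Sum>r<k. out ((r + (k - 1)) mod k))"
    using assms by (intro sum.cong) (auto simp: forward_weight_def out_def nth_rotate)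
  also have "\<dots> = (\<Sum>i<k. out i)"
    using assms by (intro sum.reindex_bij_betw bij_betw_add_mod) auto
  finally have last: "(\<Sum>r<k. forward_weight n w (rotate r xs) (k - 1)) = (\<Sum>i<k. out i)" .
  have "(\<Sum>i\<in>{1..<k - 1}. forward_weight n w (rotate r xs) i) =
     I - forward_weight n w (rotate r xs) 0 - forward_weight n w (rotate r xs) (k - 1)" for r
  proof -
    have "{..<k} = insert 0 (insert (k - 1) {1..<k - 1})" using assms by auto
    then show ?thesis using I[of "rotate r xs"] assms by simp
  qed
  then have "(\<Sum>r<k. \<Sum>i\<in>{1..<k - 1}. forward_weight n w (rotate r xs) i) =
     (\<Sum>r<k. I) - (\<Sum>i<k. d i) - (\<Sum>i<k. out i)"
    unfolding first[symmetric] last[symmetric] by (simp only: sum_subtractf)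
  also have "\<dots> = (real k - 2) * I" using twice by (simp add: algebra_simps)
  also have "\<dots> \<le> (real k - 2) * 1" using I1 assms by (intro mult_left_mono) auto
  finally show ?thesis by simp
qed

text \<open>The probability equals the product of the edge weights, divided by two, by the closing weight and by
the forward weights \<open>1, \<dots>, m - 1\<close>: the initial vertex has no forward weight in the
denominator, because the first edge is drawn from all edges. These are \<open>m\<close> factors; after
scaling by \<open>k = Suc m\<close> so that the extremal value of each becomes one, the tangent plane
bounds the product of their reciprocals by a quantity linear in them. Linearity is what allows
summing over rotations later.\<close>

lemma walk_prob_lower_bound:
  assumes xs: "distinct xs" "set xs \<subseteq> {..<n}" "length xs = Suc m" "2 \<le> m"
    and pos: "0 < (\<Prod>e\<in>closed_edges xs. w e)"
  defines "p \<equiv> \<Prod>e\<in>closed_edges xs. w e"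
  defines "lower \<equiv> p * real (Suc m) ^ m / 2 *
    (real (Suc m) - real (Suc m) *
      (w {xs ! m, xs ! 0} + (\<Sum>i\<in>{1..<m}. forward_weight n w xs i)))"
  shows "lower \<le> walk_prob n w xs"
    and "w {xs ! m, xs ! 0} \<noteq> 1 / real (Suc m) \<Longrightarrow> lower < walk_prob n w xs"
proof -
  let ?k = "real (Suc m)"
  have fin: "finite (closed_edges xs)" by (simp add: closed_edges_def)
  have epos: "0 < w e" if "e \<in> closed_edges xs" for e
  proof -
    have "e \<in> edges (complete_graph n)" using subsetD[OF closed_edges_subset[of xs n]] that xs by simp
    then have "0 \<le> w e" using wf by (simp add: weight_function_def)
    moreover have "w e \<noteq> 0" using pos that fin by (metis less_irrefl prod_zero)
    ultimately show ?thesis by simp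
  qed
  have step: "0 < w {xs ! i, xs ! Suc i}" if "i < m" for i
  proof -
    have "closed_edge xs i \<in> closed_edges xs" using that xs(3) by (simp add: closed_edges_def)
    moreover have "closed_edge xs i = {xs ! i, xs ! Suc i}" using that xs(3) by (simp add: closed_edge_def)
    ultimately show ?thesis using epos by simp
  qed
  have closing: "0 < w {xs ! m, xs ! 0}"
  proof -
    have "closed_edge xs m \<in> closed_edges xs" using xs(3) by (simp add: closed_edges_def)
    moreover have "closed_edge xs m = {xs ! m, xs ! 0}" using xs(3) by (simp add: closed_edge_def)
    ultimately show ?thesis using epos by simp
  qed
  have fw: "0 < forward_weight n w xs i" if "i < m" for i
    using weight_le_forward_weight[of xs i] step[OF that] that xs by simp
  \<comment> \<open>Index \<open>0\<close>, which carries no forward weight here, stands for the closing edge.\<close>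
  define b where "b i = (if i = 0 then w {xs ! m, xs ! 0} else forward_weight n w xs i)" for i
  define y where "y i = ?k * b i" for i
  have ypos: "0 < y i" if "i \<in> {..<m}" for i
    using that closing fw by (simp add: y_def b_def)
  have J: "{..<m} = insert 0 {1..<m}" using xs by auto
  have sumb: "(\<Sum>i<m. b i) = w {xs ! m, xs ! 0} + (\<Sum>i\<in>{1..<m}. forward_weight n w xs i)"
    unfolding J by (simp add: b_def)
  define M where "M = (\<Prod>i\<in>{1..<m}. w {xs ! i, xs ! Suc i})"
  define F where "F = (\<Prod>i\<in>{1..<m}. forward_weight n w xs i)"
  have "(\<Prod>i<m. 1 / y i) = 1 / (?k ^ m * (\<Prod>i<m. b i))"
    by (simp add: y_def prod_dividef prod.distrib)
  moreover have "(\<Prod>i<m. b i) = w {xs ! m, xs ! 0} * F"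
    unfolding J F_def by (simp add: b_def)
  moreover have "p = w {xs ! 0, xs ! 1} * M * w {xs ! m, xs ! 0}"
    unfolding p_def prod_closed_edges[OF xs(1,3,4)] J M_def by simp
  moreover have "walk_prob n w xs = w {xs ! 0, xs ! 1} / 2 * (M / F)"
    using xs(3) by (simp add: walk_prob_def prod_dividef M_def F_def)
  moreover have "0 < F" unfolding F_def by (intro prod_pos fw) auto
  moreover have "0 < ?k ^ m" by simp
  ultimately have prob: "walk_prob n w xs = p * ?k ^ m / 2 * (\<Prod>i<m. 1 / y i)"
    using closing by (simp only:) (simp add: field_simps)
  have lower: "lower = p * ?k ^ m / 2 * (1 + (\<Sum>i<m. 1 - y i))"
    unfolding lower_def by (simp add: y_def sum_subtractf sumb flip: sum_distrib_left)
  have factor: "0 < p * ?k ^ m / 2" using pos by (simp add: p_def)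
  show "lower \<le> walk_prob n w xs"
    unfolding prob lower using one_plus_sum_le_prod_inverse(1)[of "{..<m}" y] ypos factor
    by (intro mult_left_mono) auto
  assume "w {xs ! m, xs ! 0} \<noteq> 1 / ?k"
  then have "y 0 \<noteq> 1" by (auto simp: y_def b_def field_simps)
  then have "1 + (\<Sum>i<m. 1 - y i) < (\<Prod>i<m. 1 / y i)"
    using xs ypos by (intro one_plus_sum_le_prod_inverse(2)[of "{..<m}" y 0]) auto
  then show "lower < walk_prob n w xs"
    unfolding prob lower using factor by (rule mult_strict_left_mono)
qed

text \<open>Summed over all rotations, the closing weights give the weight of the cycle, at most \<open>1\<close>,
and the forward weights give at most \<open>k - 2\<close>. The linear lower bounds therefore add up to
the claimed value. Every edge closes one of the rotations, so a single edge of weight other than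
\<open>1 / k\<close> makes one of the bounds strict.\<close>

lemma sum_walk_prob_rotations:
  assumes xs: "distinct xs" "set xs \<subseteq> {..<n}" "length xs = k" "3 \<le> k"
  defines "p \<equiv> \<Prod>e\<in>closed_edges xs. w e"
  shows "real k ^ k * p / 2 \<le> (\<Sum>r<k. walk_prob n w (rotate r xs))"
    and "0 < p \<Longrightarrow> e \<in> closed_edges xs \<Longrightarrow> w e \<noteq> 1 / real k \<Longrightarrow>
      real k ^ k * p / 2 < (\<Sum>r<k. walk_prob n w (rotate r xs))"
proof -
  obtain m where m: "k = Suc m" "2 \<le> m" using xs(4) by (cases k) auto
  let ?closing = "\<lambda>r. w {rotate r xs ! m, rotate r xs ! 0}"
  let ?S = "\<lambda>r. ?closing r + (\<Sum>i\<in>{1..<m}. forward_weight n w (rotate r xs) i)"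
  let ?lower = "\<lambda>r. p * real k ^ m / 2 * (real k - real k * ?S r)"
  have p_rot: "(\<Prod>e\<in>closed_edges (rotate r xs). w e) = p" for r
    by (simp add: closed_edges_rotate p_def)
  have closing: "?closing r = w (closed_edge xs ((r + m) mod k))" for r
    using closed_edge_rotate[of m xs r] xs m by (simp add: closed_edge_def)
  have p0: "0 \<le> p"
    unfolding p_def using closed_edges_subset[of xs] xs wf
    by (intro prod_nonneg) (auto simp: weight_function_def)
  have "(\<Sum>r<k. ?closing r) = (\<Sum>i<k. w (closed_edge xs i))"
    unfolding closing using m by (intro sum.reindex_bij_betw[OF bij_betw_add_mod]) simp
  also have "\<dots> = (\<Sum>e\<in>closed_edges xs. w e)"
    unfolding closed_edges_def using inj_on_closed_edge[of xs] xs by (simp add: sum.reindex)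
  also have "\<dots> \<le> 1" using closed_edges_subset[of xs] xs by (intro sum_weights_le_one) auto
  finally have "(\<Sum>r<k. ?S r) \<le> real k - 1"
    using sum_forward_weight_rotations[OF xs] m by (simp add: sum.distrib)
  then have "real k * (\<Sum>r<k. ?S r) \<le> real k * (real k - 1)"
    by (rule mult_left_mono) simp
  moreover have "(\<Sum>r<k. real k - real k * ?S r) = real k * real k - real k * (\<Sum>r<k. ?S r)"
    by (simp only: sum_subtractf sum_distrib_left[symmetric]) simp
  ultimately have "real k \<le> (\<Sum>r<k. real k - real k * ?S r)"
    by (simp only: right_diff_distrib)
  then have "p * real k ^ m / 2 * real k \<le> p * real k ^ m / 2 * (\<Sum>r<k. real k - real k * ?S r)"
    using p0 by (intro mult_left_mono) auto
  then have total: "real k ^ k * p / 2 \<le> (\<Sum>r<k. ?lower r)"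
    unfolding sum_distrib_left using m(1) by (simp add: mult_ac)
  have lower: "?lower r \<le> walk_prob n w (rotate r xs)" for r
  proof (cases "p = 0")
    case True
    then show ?thesis using walk_prob_nonneg[of "rotate r xs"] xs by simp
  next
    case False
    then show ?thesis
      using walk_prob_lower_bound(1)[of "rotate r xs" m] xs m p_rot p0 by simp
  qed
  with total show "real k ^ k * p / 2 \<le> (\<Sum>r<k. walk_prob n w (rotate r xs))"
    by (meson order_trans sum_mono)
  assume p: "0 < p" and e: "e \<in> closed_edges xs" "w e \<noteq> 1 / real k"
  obtain i where i: "i < k" "e = closed_edge xs i"
    using e(1) xs by (auto simp: closed_edges_def)
  have "i \<in> (\<lambda>r. (r + m) mod k) ` {..<k}"
    using bij_betw_imp_surj_on[OF bij_betw_add_mod[of k m]] i(1) by simp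
  then obtain r where r: "r < k" "(r + m) mod k = i" by blast
  have "?closing r \<noteq> 1 / real k" using closing[of r] r(2) i(2) e(2) by simp
  then have "?lower r < walk_prob n w (rotate r xs)"
    using walk_prob_lower_bound(2)[of "rotate r xs" m] xs m p_rot p by simp
  then have "(\<Sum>r<k. ?lower r) < (\<Sum>r<k. walk_prob n w (rotate r xs))"
    using r(1) lower by (intro sum_strict_mono_ex1) auto
  with total show "real k ^ k * p / 2 < (\<Sum>r<k. walk_prob n w (rotate r xs))" by linarith
qed

text \<open>The rotations of a traversal and those of its reversal are disjoint families of traversals of the
same cycle, and each family contributes one half.\<close>

lemma tracing_prob_ge:
  assumes k: "3 \<le> k" and C: "C \<in> cycles_in n k"
  shows "real k ^ k * (\<Prod>e\<in>edges C. w e) \<le> (\<Sum>ys\<in>tracings n k (edges C). walk_prob n w ys)"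
    and "0 < (\<Prod>e\<in>edges C. w e) \<Longrightarrow> e \<in> edges C \<Longrightarrow> w e \<noteq> 1 / real k \<Longrightarrow>
      real k ^ k * (\<Prod>e\<in>edges C. w e) < (\<Sum>ys\<in>tracings n k (edges C). walk_prob n w ys)"
proof -
  define F where "F = edges C"
  obtain xs where xs: "xs \<in> tracings n k F"
    using tracing_exists[OF k C] by (auto simp: F_def)
  let ?A = "(\<lambda>r. rotate r xs) ` {..<k}" and ?B = "(\<lambda>r. rotate r (rev xs)) ` {..<k}"
  let ?P = "walk_prob n w"
  have x: "length xs = k" "distinct xs" "set xs \<subseteq> {..<n}" "closed_edges xs = F"
    using xs by (auto simp: tracings_def distinct_lists_def)
  have disj: "?A \<inter> ?B = {}"
  proof (rule ccontr)
    assume "?A \<inter> ?B \<noteq> {}"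
    then obtain r s where "rotate r xs = rotate s (rev xs)" "s < k" by auto
    then have "rev xs = rotate (k - s + r) xs"
      using rotate_eq_rotateD[of r xs s "rev xs"] x by simp
    then show False using rev_not_rotate[of xs] x k by simp
  qed
  have fin: "finite (tracings n k F)"
    by (simp add: tracings_def finite_distinct_lists)
  have sub: "?A \<union> ?B \<subseteq> tracings n k F"
    using x by (auto simp: tracings_def distinct_lists_def closed_edges_rotate closed_edges_rev)
  have "(\<Sum>r<k. ?P (rotate r xs)) + (\<Sum>r<k. ?P (rotate r (rev xs))) = sum ?P ?A + sum ?P ?B"
    using inj_on_rotate[of xs] inj_on_rotate[of "rev xs"] x by (simp add: sum.reindex)
  also have "\<dots> = sum ?P (?A \<union> ?B)"
    using disj by (subst sum.union_disjoint) auto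
  also have "\<dots> \<le> sum ?P (tracings n k F)"
    using fin sub k by (intro sum_mono2) (auto simp: tracings_def distinct_lists_def intro: walk_prob_nonneg)
  finally have le: "(\<Sum>r<k. ?P (rotate r xs)) + (\<Sum>r<k. ?P (rotate r (rev xs))) \<le> sum ?P (tracings n k F)" .
  note fwd = sum_walk_prob_rotations[of xs k] and bwd = sum_walk_prob_rotations[of "rev xs" k]
  show "real k ^ k * (\<Prod>e\<in>edges C. w e) \<le> sum ?P (tracings n k (edges C))"
    unfolding F_def[symmetric] using le fwd(1) bwd(1) x k by (simp add: closed_edges_rev)
  assume "0 < (\<Prod>e\<in>edges C. w e)" "e \<in> edges C" "w e \<noteq> 1 / real k"
  then show "real k ^ k * (\<Prod>e\<in>edges C. w e) < sum ?P (tracings n k (edges C))"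
    unfolding F_def[symmetric] using le fwd(2)[of e] bwd(1) x k by (simp add: closed_edges_rev)
qed

text \<open>A cycle is determined by its edges, so different cycles have no traversal in common.\<close>

lemma sum_tracing_probs_le_one:
  assumes k: "3 \<le> k"
  shows "(\<Sum>C\<in>cycles_in n k. \<Sum>xs\<in>tracings n k (edges C). walk_prob n w xs) \<le> 1"
proof -
  obtain m where m: "k = Suc (Suc m)" using k le_Suc_ex[of 2 k] by auto
  have disj: "tracings n k (edges C) \<inter> tracings n k (edges D) = {}"
    if "C \<in> cycles_in n k" "D \<in> cycles_in n k" "C \<noteq> D" for C D
  proof -
    have "edges C \<noteq> edges D"
      using that verts_cycles_in[OF k] by (metis prod.collapse)
    then show ?thesis by (auto simp: tracings_def)
  qed
  have "(\<Sum>C\<in>cycles_in n k. \<Sum>xs\<in>tracings n k (edges C). walk_prob n w xs) =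
     (\<Sum>xs\<in>(\<Union>C\<in>cycles_in n k. tracings n k (edges C)). walk_prob n w xs)"
  proof (rule sum.UNION_disjoint[symmetric, OF finite_cycles_in])
    show "\<forall>C\<in>cycles_in n k. finite (tracings n k (edges C))"
      by (simp add: tracings_def finite_distinct_lists)
  qed (use disj in blast)
  also have "\<dots> \<le> (\<Sum>xs\<in>distinct_lists n k. walk_prob n w xs)"
    using k by (intro sum_mono2 finite_distinct_lists)
      (auto simp: tracings_def distinct_lists_def intro: walk_prob_nonneg)
  also have "\<dots> \<le> 1" unfolding m by (rule sum_walk_prob_le_one)
  finally show ?thesis .
qed

section \<open>The bound and the case of equality\<close>

lemma beta_weight_le:
  assumes "3 \<le> k"
  shows "real k ^ k * beta_weight n w k \<le> 1"
proof -
  have "real k ^ k * beta_weight n w k = (\<Sum>C\<in>cycles_in n k. real k ^ k * (\<Prod>e\<in>edges C. w e))"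
    by (simp add: beta_weight_def subgraph_weight_def sum_distrib_left)
  also have "\<dots> \<le> (\<Sum>C\<in>cycles_in n k. \<Sum>xs\<in>tracings n k (edges C). walk_prob n w xs)"
    by (intro sum_mono tracing_prob_ge(1)[OF assms])
  also have "\<dots> \<le> 1" by (rule sum_tracing_probs_le_one[OF assms])
  finally show ?thesis .
qed

lemma weight_eq_if_beta_weight_eq:
  assumes k: "3 \<le> k" and eq: "real k ^ k * beta_weight n w k = 1"
    and C: "C \<in> cycles_in n k" "0 < (\<Prod>e\<in>edges C. w e)" and e: "e \<in> edges C"
  shows "w e = 1 / real k"
proof (rule ccontr)
  assume ne: "w e \<noteq> 1 / real k"
  have "1 = (\<Sum>C\<in>cycles_in n k. real k ^ k * (\<Prod>e\<in>edges C. w e))"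
    using eq by (simp add: beta_weight_def subgraph_weight_def sum_distrib_left)
  also have "\<dots> < (\<Sum>C\<in>cycles_in n k. \<Sum>xs\<in>tracings n k (edges C). walk_prob n w xs)"
  proof (rule sum_strict_mono_ex1[OF finite_cycles_in])
    show "\<forall>C\<in>cycles_in n k. real k ^ k * (\<Prod>e\<in>edges C. w e)
        \<le> (\<Sum>xs\<in>tracings n k (edges C). walk_prob n w xs)"
      using tracing_prob_ge(1)[OF k] by blast
    have "real k ^ k * (\<Prod>e\<in>edges C. w e) < (\<Sum>xs\<in>tracings n k (edges C). walk_prob n w xs)"
      using C(2) e ne by (rule tracing_prob_ge(2)[OF k C(1)])
    then show "\<exists>C\<in>cycles_in n k. real k ^ k * (\<Prod>e\<in>edges C. w e)
        < (\<Sum>xs\<in>tracings n k (edges C). walk_prob n w xs)"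
      using C(1) by blast
  qed
  also have "\<dots> \<le> 1" by (rule sum_tracing_probs_le_one[OF k])
  finally show False by simp
qed

text \<open>Some cycle has positive weight, and its \<open>k\<close> edges of weight \<open>1 / k\<close> exhaust
the total weight.\<close>

lemma balanced_cycle_if_beta_weight_eq:
  assumes k: "3 \<le> k" and eq: "real k ^ k * beta_weight n w k = 1"
  shows "\<exists>C\<in>cycles_in n k. (\<forall>e\<in>edges C. w e = 1 / real k) \<and>
    (\<forall>e\<in>edges (complete_graph n) - edges C. w e = 0)"
proof -
  let ?E = "edges (complete_graph n)"
  have w0: "0 \<le> w e" if "e \<in> ?E" for e using that wf by (simp add: weight_function_def)
  have sub: "edges C \<subseteq> ?E" if "C \<in> cycles_in n k" for C
    using that by (auto simp: cycles_in_def subgraph_def)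
  have "beta_weight n w k \<noteq> 0" using eq by auto
  then obtain C where C: "C \<in> cycles_in n k" "(\<Prod>e\<in>edges C. w e) \<noteq> 0"
    unfolding beta_weight_def subgraph_weight_def by (meson sum.neutral)
  have "0 \<le> (\<Prod>e\<in>edges C. w e)" using sub[OF C(1)] w0 by (intro prod_nonneg) auto
  with C(2) have bal: "w e = 1 / real k" if "e \<in> edges C" for e
    using weight_eq_if_beta_weight_eq[OF k eq C(1) _ that] by simp
  obtain xs where xs: "xs \<in> tracings n k (edges C)" using tracing_exists[OF k C(1)] by blast
  then have "card (edges C) = k"
    using card_image[OF inj_on_closed_edge[of xs]] k
    by (auto simp: tracings_def distinct_lists_def closed_edges_def)
  then have "(\<Sum>e\<in>edges C. w e) = 1" using bal k by simp
  moreover have "(\<Sum>e\<in>?E. w e) = (\<Sum>e\<in>?E - edges C. w e) + (\<Sum>e\<in>edges C. w e)"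
    by (rule sum.subset_diff[OF sub[OF C(1)] finite_edges_complete_graph])
  ultimately have "(\<Sum>e\<in>?E - edges C. w e) = 0"
    using wf by (simp add: weight_function_def)
  then have "\<forall>e\<in>?E - edges C. w e = 0"
    using w0 by (subst (asm) sum_nonneg_eq_0_iff) (auto simp: finite_edges_complete_graph)
  with bal C(1) show ?thesis by blast
qed

end

theorem theorem2:
  fixes k :: nat
  assumes "k \<ge> 3"
  shows "beta k \<le> 1 / real k ^ k \<and>
    (\<forall>n w. n > 0 \<and> weight_function n w \<and> beta_weight n w k = 1 / real k ^ k \<longrightarrow>
      (\<exists>C\<in>cycles_in n k.
        (\<forall>e\<in>edges C. w e = 1 / real k) \<and>
        (\<forall>e\<in>edges (complete_graph n) - edges C. w e = 0)))"
proof (intro conjI allI impI)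
  have k: "0 < real k ^ k" using assms by simp
  show "beta k \<le> 1 / real k ^ k"
    unfolding beta_def
  proof (rule cSup_least[OF beta_values_nonempty])
    fix b assume "b \<in> beta_values k"
    then obtain n w where "b = beta_weight n w k" "weight_function n w"
      by (auto simp: beta_values_def)
    then show "b \<le> 1 / real k ^ k"
      using beta_weight_le[of n w k] assms k by (simp add: field_simps)
  qed
  fix n w
  assume "n > 0 \<and> weight_function n w \<and> beta_weight n w k = 1 / real k ^ k"
  then show "\<exists>C\<in>cycles_in n k. (\<forall>e\<in>edges C. w e = 1 / real k) \<and>
      (\<forall>e\<in>edges (complete_graph n) - edges C. w e = 0)"
    using k by (intro balanced_cycle_if_beta_weight_eq[OF _ assms]) auto
qed

end
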